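(* (i) For integers $k\ge 2$, $\ell$ and $n$ with $\ell \le n$ and $\ell \geq \log_2(2k)$, we have $\mathbf{d}(Q_n, Q_\ell, C_{2k}) = 0$. (ii) For each integer $k \geq 4$ with $k \neq 5$ there is a positive constant $c_k$ such that for all integers $\ell, n$ with $2 \leq \ell < \log_2(2k) \leq n$, setting $m := \lceil \log_2(2k) \rceil -1$, \[ \binom{m}{\ell}\binom{n}{\ell}^{-1} \leq \mathbf{d}(Q_n, Q_\ell, C_{2k}) \leq c_k\, n^{-\frac{1}{16}}.\]
   Context: $Q_n$ denotes the $n$-dimensional hypercube: its vertices are the binary vectors of length $n$, two vectors being adjacent iff they differ in exactly one coordinate. $C_m$ is the cycle on $m$ vertices. For graphs $G$ and $T$, a copy of $T$ in $G$ is a subgraph of $G$ isomorphic to $T$, and $N(G,T)$ is the number of copies of $T$ in $G$. A graph is $H$-free if it has no subgraph isomorphic to $H$. For subgraphs $T,H$ of $G$, $\mathrm{ex}(G,T,H)=\max\{N(G',T): G'\subseteq G,\ G' \text{ is } H\text{-free}\}$ and $\mathbf{d}(G,T,H)=\mathrm{ex}(G,T,H)/N(G,T)$. *)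

theory Defs
  imports Complex_Main
begin

type_synonym 'a graph = "'a set \<times> 'a set set"

abbreviation verts :: "'a graph \<Rightarrow> 'a set" where
  "verts \<equiv> fst"

abbreviation edges :: "'a graph \<Rightarrow> 'a set set" where
  "edges \<equiv> snd"

definition simple_graph :: "'a graph \<Rightarrow> bool" where
  "simple_graph G \<longleftrightarrow>
     finite (verts G) \<and> (\<forall>e\<in>edges G. \<exists>u\<in>verts G. \<exists>v\<in>verts G. u \<noteq> v \<and> e = {u, v})"

definition subgraph :: "'a graph \<Rightarrow> 'a graph \<Rightarrow> bool" where
  "subgraph S G \<longleftrightarrow> simple_graph S \<and> verts S \<subseteq> verts G \<and> edges S \<subseteq> edges G"

definition isomorphic :: "'a graph \<Rightarrow> 'b graph \<Rightarrow> bool" where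
  "isomorphic G H \<longleftrightarrow>
     (\<exists>f. bij_betw f (verts G) (verts H) \<and>
          (\<forall>u\<in>verts G. \<forall>v\<in>verts G. {u, v} \<in> edges G \<longleftrightarrow> {f u, f v} \<in> edges H))"

definition copies :: "'a graph \<Rightarrow> 'b graph \<Rightarrow> 'a graph set" where
  "copies G T = {S. subgraph S G \<and> isomorphic S T}"

definition num_copies :: "'a graph \<Rightarrow> 'b graph \<Rightarrow> nat" where
  "num_copies G T = card (copies G T)"

definition graph_free :: "'a graph \<Rightarrow> 'b graph \<Rightarrow> bool" where
  "graph_free G H \<longleftrightarrow> \<not> (\<exists>S. subgraph S G \<and> isomorphic S H)"

definition ex_num :: "'a graph \<Rightarrow> 'b graph \<Rightarrow> 'c graph \<Rightarrow> nat" where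
  "ex_num G T H = Max {num_copies G' T |G'. subgraph G' G \<and> graph_free G' H}"

(* Only meaningful if G contains a copy of T; otherwise the quotient is 0 / 0 = 0. *)
definition ex_density :: "'a graph \<Rightarrow> 'b graph \<Rightarrow> 'c graph \<Rightarrow> real" where
  "ex_density G T H = real (ex_num G T H) / real (num_copies G T)"

definition hypercube :: "nat \<Rightarrow> bool list graph" where
  "hypercube n =
     ({x. length x = n},
      {{x, y} |x y. length x = n \<and> length y = n \<and> card {i. i < n \<and> x ! i \<noteq> y ! i} = 1})"

(* A simple graph only for m \<ge> 3. *)
definition cycle_graph :: "nat \<Rightarrow> nat graph" where
  "cycle_graph m = ({..<m}, {{i, (i + 1) mod m} |i. i < m})"

lemma simple_graph_hypercube: "simple_graph (hypercube n)"
proof -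
  have "finite {x :: bool list. length x = n}"
    using finite_lists_length_eq[of "UNIV :: bool set" n] by simp
  then show ?thesis
    by (fastforce simp: simple_graph_def hypercube_def)
qed

lemma simple_graph_cycle_graph:
  assumes "m \<ge> 3"
  shows "simple_graph (cycle_graph m)"
proof -
  have "(i + 1) mod m < m \<and> i \<noteq> (i + 1) mod m" if "i < m" for i
  proof (cases "i + 1 = m")
    case False
    with that have "i + 1 < m" by simp
    then show ?thesis by simp
  qed (use assms that in auto)
  then show ?thesis
    unfolding simple_graph_def cycle_graph_def by fastforce
qed

lemma finite_subgraphs:
  assumes "simple_graph G"
  shows "finite {S. subgraph S G}"
proof (rule finite_subset)
  show "{S. subgraph S G} \<subseteq> Pow (verts G) \<times> Pow (edges G)"
    by (auto simp: subgraph_def)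
  have "edges G \<subseteq> Pow (verts G)" and "finite (verts G)"
    using assms by (auto simp: simple_graph_def)
  then show "finite (Pow (verts G) \<times> Pow (edges G))"
    by (intro finite_cartesian_product) (auto intro: finite_subset)
qed

text \<open>The maximum in the definition of \<open>ex_num\<close> is taken over a finite nonempty set.\<close>

lemma finite_ex_num_set:
  assumes "simple_graph G"
  shows "finite {num_copies G' T |G'. subgraph G' G \<and> graph_free G' H}"
proof -
  have "finite {G'. subgraph G' G \<and> graph_free G' H}"
    using finite_subgraphs[OF assms] by (rule rev_finite_subset) auto
  then show ?thesis by (rule finite_image_set)
qed

lemma ex_num_set_nonempty:
  assumes "verts H \<noteq> {}"
  shows "{num_copies G' T |G'. subgraph G' G \<and> graph_free G' H} \<noteq> {}"
proof -
  have "subgraph ({}, {}) G"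
    by (simp add: subgraph_def simple_graph_def)
  moreover have "graph_free ({}, {}) H"
    using assms by (auto simp: graph_free_def subgraph_def isomorphic_def bij_betw_def)
  ultimately show ?thesis by blast
qed

end

theory Submission
  imports Defs
begin

text \<open>
  A subgraph of \<open>Q_n\<close> isomorphic to \<open>Q_l\<close> is a subcube, so it is determined by any one of its
  vertices and its set of \<open>l\<close> directions; hence counting copies amounts to counting pairs
  (vertex, set of directions).

  Part (i): a path on \<open>k\<close> vertices in \<open>Q_(l-1)\<close> (an initial piece of a Gray code), its translate
  in the opposite facet and the two connecting edges form a \<open>C_2k\<close> in \<open>Q_l\<close>.

  Lower bound: the edges in the first \<open>m\<close> directions form disjoint copies of \<open>Q_m\<close>, which have
  fewer than \<open>2k\<close> vertices.

  Upper bound: at a vertex \<open>v\<close> of a \<open>C_2k\<close>-free \<open>G\<close>, join the directions \<open>a\<close>, \<open>b\<close> if \<open>G\<close> contains the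
  whole 4-cycle at \<open>v\<close> in these directions. A path \<open>a_1, ..., a_k\<close> in this auxiliary graph would give
  the cycle \<open>v, v + a_1, v + a_1 + a_2, v + a_2, ..., v + a_k\<close> of length \<open>2k\<close> in \<open>G\<close>. So the
  auxiliary graph has only \<open>O(n)\<close> edges, and as \<open>l \<ge> 2\<close> every copy of \<open>Q_l\<close> through \<open>v\<close> uses one of
  them. The density is therefore even \<open>O(1/n)\<close>.
\<close>

section \<open>Subcubes\<close>

text \<open>Addition over GF(2) of the indicator vector of \<open>A\<close>. Indices in
  \<open>A\<close> beyond the length have no effect, which is why injectivity below is stated for
  subsets of \<open>{..<length x}\<close>.\<close>

definition flip :: "bool list \<Rightarrow> nat set \<Rightarrow> bool list" where
  "flip x A = map (\<lambda>i. x ! i \<noteq> (i \<in> A)) [0..<length x]"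

lemma length_flip [simp]: "length (flip x A) = length x"
  by (simp add: flip_def)

lemma nth_flip [simp]: "i < length x \<Longrightarrow> flip x A ! i = (x ! i \<noteq> (i \<in> A))"
  by (simp add: flip_def)

lemma flip_empty [simp]: "flip x {} = x"
  by (simp add: list_eq_iff_nth_eq)

lemma flip_flip [simp]: "flip (flip x A) B = flip x (sym_diff A B)"
  by (auto simp: list_eq_iff_nth_eq)

lemma flip_eq_iff:
  "A \<subseteq> {..<length x} \<Longrightarrow> B \<subseteq> {..<length x} \<Longrightarrow> flip x A = flip x B \<longleftrightarrow> A = B"
  by (auto simp: list_eq_iff_nth_eq)

lemma inj_on_flip: "inj_on (flip x) (Pow {..<length x})"
  by (auto simp: inj_on_def flip_eq_iff)

lemma ex_flip:
  assumes "length y = length x"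
  shows "\<exists>A\<subseteq>{..<length x}. y = flip x A"
  using assms
  by (intro exI[of _ "{i. i < length x \<and> x ! i \<noteq> y ! i}"]) (auto simp: list_eq_iff_nth_eq)

lemma flip_image_Pow: "flip x ` Pow {..<length x} = {y. length y = length x}"
  using ex_flip by auto

lemma finite_lists_length: "finite {x :: bool list. length x = n}"
  using finite_lists_length_eq[of "UNIV :: bool set" n] by simp

lemma card_lists_length: "card {x :: bool list. length x = n} = 2 ^ n"
  using card_lists_length_eq[of "UNIV :: bool set" n] by simp

text \<open>Replaces the symmetric set-builder form of the edges by a move from \<open>x\<close> in
  a single direction, the form in which all later arguments use adjacency.\<close>

lemma edge_hypercube_iff:
  "{x, y} \<in> edges (hypercube n) \<longleftrightarrow> length x = n \<and> (\<exists>i<n. y = flip x {i})"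
proof
  assume "{x, y} \<in> edges (hypercube n)"
  then obtain x' y' where *: "{x, y} = {x', y'}" "length x' = n" "length y' = n"
    "card {i. i < n \<and> x' ! i \<noteq> y' ! i} = 1"
    by (auto simp: hypercube_def)
  have sym: "{i. i < n \<and> x' ! i \<noteq> y' ! i} = {i. i < n \<and> y' ! i \<noteq> x' ! i}"
    by blast
  from *(1) have "x = x' \<and> y = y' \<or> x = y' \<and> y = x'"
    by (simp only: doubleton_eq_iff)
  then have len: "length x = n" "length y = n"
    and card: "card {i. i < n \<and> x ! i \<noteq> y ! i} = 1"
    using *(2,3) *(4)[unfolded sym] *(4) by (elim disjE; simp)+
  from card obtain i where i: "{i. i < n \<and> x ! i \<noteq> y ! i} = {i}"
    by (rule card_1_singletonE)
  then have "i < n" by auto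
  moreover have "y = flip x {i}"
    using len i by (auto simp: list_eq_iff_nth_eq set_eq_iff)
  ultimately show "length x = n \<and> (\<exists>i<n. y = flip x {i})"
    using len by blast
next
  assume "length x = n \<and> (\<exists>i<n. y = flip x {i})"
  then obtain i where i: "length x = n" "i < n" "y = flip x {i}" by blast
  then have "{j. j < n \<and> x ! j \<noteq> y ! j} = {i}" by auto
  then have "card {j. j < n \<and> x ! j \<noteq> y ! j} = 1" by simp
  with i show "{x, y} \<in> edges (hypercube n)"
    unfolding hypercube_def snd_conv mem_Collect_eq
    by (intro exI[of _ x] exI[of _ y] conjI) simp_all
qed

text \<open>The base point \<open>x\<close> is not canonical: any vertex of the subcube would do.
  This freedom lets copies be counted together with a chosen vertex.\<close>

definition subcube :: "bool list \<Rightarrow> nat set \<Rightarrow> bool list graph" where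
  "subcube x D = (flip x ` Pow D, {{y, flip y {i}} |y i. y \<in> flip x ` Pow D \<and> i \<in> D})"

lemma verts_subcube: "verts (subcube x D) = flip x ` Pow D"
  by (simp add: subcube_def)

lemma flip_in_subcube:
  assumes "y \<in> verts (subcube x D)" "A \<subseteq> D"
  shows "flip y A \<in> verts (subcube x D)"
proof -
  obtain B where "B \<subseteq> D" "y = flip x B"
    using assms by (auto simp: verts_subcube)
  then show ?thesis
    using assms by (auto simp: verts_subcube intro!: imageI)
qed

lemma edge_subcube_iff:
  "{y, z} \<in> edges (subcube x D) \<longleftrightarrow> y \<in> verts (subcube x D) \<and> (\<exists>i\<in>D. z = flip y {i})"
proof
  assume "{y, z} \<in> edges (subcube x D)"
  then obtain w i where w: "w \<in> verts (subcube x D)" "i \<in> D" "{y, z} = {w, flip w {i}}"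
    by (auto simp: subcube_def)
  then have "flip w {i} \<in> verts (subcube x D)"
    by (intro flip_in_subcube) auto
  then show "y \<in> verts (subcube x D) \<and> (\<exists>i\<in>D. z = flip y {i})"
    using w by (auto simp: doubleton_eq_iff intro!: bexI[of _ i])
qed (auto simp: subcube_def)

lemma subgraph_subcube_hypercube:
  assumes "D \<subseteq> {..<length x}"
  shows "subgraph (subcube x D) (hypercube (length x))"
proof -
  have "\<exists>u\<in>verts (subcube x D). \<exists>v\<in>verts (subcube x D). u \<noteq> v \<and> e = {u, v}"
    if "e \<in> edges (subcube x D)" for e
  proof -
    from that obtain y i where y: "y \<in> verts (subcube x D)" "i \<in> D" "e = {y, flip y {i}}"
      by (auto simp: subcube_def)
    have "length y = length x" using y(1) by (auto simp: verts_subcube)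
    then have "y \<noteq> flip y {i}"
      using flip_eq_iff[of "{}" y "{i}"] y assms by auto
    moreover have "flip y {i} \<in> verts (subcube x D)"
      using y by (intro flip_in_subcube) auto
    ultimately show ?thesis using y by blast
  qed
  moreover have "finite D" using assms finite_subset by blast
  moreover have "edges (subcube x D) \<subseteq> edges (hypercube (length x))"
  proof
    fix e assume "e \<in> edges (subcube x D)"
    then obtain y i where y: "y \<in> verts (subcube x D)" "i \<in> D" "e = {y, flip y {i}}"
      by (auto simp: subcube_def)
    have "length y = length x" using y(1) by (auto simp: verts_subcube)
    then show "e \<in> edges (hypercube (length x))"
      using y assms by (auto simp: edge_hypercube_iff)
  qed
  ultimately show ?thesis
    by (auto simp: subgraph_def simple_graph_def verts_subcube hypercube_def)
qed

text \<open>Since \<open>flip x\<close> is injective on sets of directions, the vertex set already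
  determines \<open>Pow D\<close>.\<close>

lemma subcube_inject:
  assumes "subcube x D = subcube x E" "D \<subseteq> {..<length x}" "E \<subseteq> {..<length x}"
  shows "D = E"
proof -
  have "flip x ` Pow D = flip x ` Pow E"
    using assms(1) by (metis verts_subcube)
  then have "Pow D = Pow E"
    using assms(2,3) by (subst (asm) inj_on_image_eq_iff[OF inj_on_flip]) auto
  then show ?thesis by blast
qed

lemma image_sym_diff:
  assumes "inj_on f C" "A \<subseteq> C" "B \<subseteq> C"
  shows "f ` sym_diff A B = sym_diff (f ` A) (f ` B)"
  using assms inj_on_image_set_diff[of f C A B] inj_on_image_set_diff[of f C B A]
  by (auto simp: image_Un)

section \<open>Subgraphs and isomorphisms\<close>

lemma subgraph_trans: "subgraph S G \<Longrightarrow> subgraph G H \<Longrightarrow> subgraph S H"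
  by (auto simp: subgraph_def)

text \<open>The definition of \<open>isomorphic\<close> asks for a map from the copy to the model
  graph. This rule and the next one work with the inverse map, from the model to the copy, where
  vertices have concrete names.\<close>

lemma isomorphicI:
  assumes "bij_betw h (verts H) (verts G)"
    and "\<And>u v. u \<in> verts H \<Longrightarrow> v \<in> verts H \<Longrightarrow> {u, v} \<in> edges H \<longleftrightarrow> {h u, h v} \<in> edges G"
  shows "isomorphic G H"
  unfolding isomorphic_def
proof (intro exI[of _ "inv_into (verts H) h"] conjI ballI)
  show "bij_betw (inv_into (verts H) h) (verts G) (verts H)"
    using assms(1) by (rule bij_betw_inv_into)
  fix u v assume uv: "u \<in> verts G" "v \<in> verts G"
  then have "u \<in> h ` verts H" "v \<in> h ` verts H"
    using assms(1) by (auto simp: bij_betw_def)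
  then show "({u, v} \<in> edges G) = ({inv_into (verts H) h u, inv_into (verts H) h v} \<in> edges H)"
    by (subst assms(2)) (auto simp: inv_into_into f_inv_into_f)
qed

lemma isomorphicE:
  assumes "isomorphic G H"
  obtains h where "bij_betw h (verts H) (verts G)"
    "\<And>u v. u \<in> verts H \<Longrightarrow> v \<in> verts H \<Longrightarrow> {u, v} \<in> edges H \<longleftrightarrow> {h u, h v} \<in> edges G"
proof -
  from assms obtain f where f: "bij_betw f (verts G) (verts H)"
    "\<And>u v. u \<in> verts G \<Longrightarrow> v \<in> verts G \<Longrightarrow> {u, v} \<in> edges G \<longleftrightarrow> {f u, f v} \<in> edges H"
    by (auto simp: isomorphic_def)
  show ?thesis
  proof (rule that[of "inv_into (verts G) f"])
    show "bij_betw (inv_into (verts G) f) (verts H) (verts G)"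
      using f(1) by (rule bij_betw_inv_into)
    fix u v assume "u \<in> verts H" "v \<in> verts H"
    then have "u \<in> f ` verts G" "v \<in> f ` verts G"
      using f(1) by (auto simp: bij_betw_def)
    then show "{u, v} \<in> edges H \<longleftrightarrow> {inv_into (verts G) f u, inv_into (verts G) f v} \<in> edges G"
      by (subst f(2)) (auto simp: inv_into_into f_inv_into_f)
  qed
qed

lemma subcube_isomorphic:
  assumes D: "D \<subseteq> {..<length x}"
  shows "isomorphic (subcube x D) (hypercube (card D))"
proof -
  have "finite D" using D finite_subset by blast
  then obtain e where e: "bij_betw e {..<card D} D"
    using ex_bij_betw_nat_finite by (auto simp: atLeast0LessThan)
  \<comment> \<open>A list of length \<open>card D\<close> is read as a set of indices, which the
    enumeration \<open>e\<close> carries to a set of directions in \<open>D\<close>.\<close>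
  define h where "h = (\<lambda>u. flip x (e ` {i. i < card D \<and> u ! i}))"
  have h_flip: "h (flip u {i}) = flip (h u) {e i}" if "length u = card D" "i < card D" for u i
  proof -
    have "e ` {j. j < card D \<and> flip u {i} ! j} = sym_diff (e ` {j. j < card D \<and> u ! j}) {e i}"
    proof -
      have "{j. j < card D \<and> flip u {i} ! j} = sym_diff {j. j < card D \<and> u ! j} {i}"
        using that by auto
      moreover have "inj_on e {..<card D}" using e by (simp add: bij_betw_def)
      then have "e ` sym_diff {j. j < card D \<and> u ! j} {i} =
          sym_diff (e ` {j. j < card D \<and> u ! j}) (e ` {i})"
        using that by (intro image_sym_diff) auto
      ultimately show ?thesis by simp
    qed
    then show ?thesis by (simp add: h_def)
  qed
  have inj: "inj_on h {u. length u = card D}"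
  proof (rule inj_onI)
    fix u w assume uw: "u \<in> {u. length u = card D}" "w \<in> {u. length u = card D}" "h u = h w"
    have "e ` {i. i < card D \<and> u ! i} = e ` {i. i < card D \<and> w ! i}"
      using e D uw(3) unfolding h_def
      by (subst (asm) flip_eq_iff) (auto simp: bij_betw_def)
    then have "{i. i < card D \<and> u ! i} = {i. i < card D \<and> w ! i}"
      using e by (subst (asm) inj_on_image_eq_iff[of e "{..<card D}"]) (auto simp: bij_betw_def)
    then show "u = w" using uw by (auto simp: list_eq_iff_nth_eq)
  qed
  have surj: "h ` {u. length u = card D} = verts (subcube x D)"
  proof (intro subset_antisym subsetI)
    fix y assume "y \<in> verts (subcube x D)"
    then obtain A where A: "A \<subseteq> D" "y = flip x A" by (auto simp: verts_subcube)
    define u where "u = map (\<lambda>i. e i \<in> A) [0..<card D]"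
    have "{i. i < card D \<and> u ! i} = {i \<in> {..<card D}. e i \<in> A}"
      by (auto simp: u_def)
    moreover have "e ` {i \<in> {..<card D}. e i \<in> A} = A"
      using A(1) bij_betw_imp_surj_on[OF e] by auto
    ultimately have "e ` {i. i < card D \<and> u ! i} = A" by simp
    then have "y = h u" using A by (simp add: h_def)
    then show "y \<in> h ` {u. length u = card D}" by (auto simp: u_def)
  qed (use e in \<open>auto simp: h_def verts_subcube bij_betw_def\<close>)
  show ?thesis
  proof (rule isomorphicI[of h])
    show "bij_betw h (verts (hypercube (card D))) (verts (subcube x D))"
      using inj surj by (simp add: bij_betw_def hypercube_def)
    fix u w assume "u \<in> verts (hypercube (card D))" "w \<in> verts (hypercube (card D))"
    then have len: "length u = card D" "length w = card D" by (auto simp: hypercube_def)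
    show "{u, w} \<in> edges (hypercube (card D)) \<longleftrightarrow> {h u, h w} \<in> edges (subcube x D)"
    proof
      assume "{u, w} \<in> edges (hypercube (card D))"
      then obtain i where i: "i < card D" "w = flip u {i}"
        by (auto simp: edge_hypercube_iff)
      then have "h w = flip (h u) {e i}" using len h_flip by simp
      moreover have "e i \<in> D" using i e by (auto simp: bij_betw_def)
      moreover have "h u \<in> verts (subcube x D)" using len surj by blast
      ultimately show "{h u, h w} \<in> edges (subcube x D)"
        by (auto simp: edge_subcube_iff)
    next
      assume "{h u, h w} \<in> edges (subcube x D)"
      then obtain j where j: "j \<in> D" "h w = flip (h u) {j}"
        by (auto simp: edge_subcube_iff)
      then obtain i where "i < card D" "j = e i"
        using bij_betw_imp_surj_on[OF e] by (auto simp: image_iff)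
      with j have "i < card D" "h w = flip (h u) {e i}" by simp_all
      then have "h w = h (flip u {i})" using len h_flip by simp
      then have "w = flip u {i}" using len inj by (auto simp: inj_on_def)
      then show "{u, w} \<in> edges (hypercube (card D))"
        using len \<open>i < card D\<close> by (auto simp: edge_hypercube_iff)
    qed
  qed
qed

section \<open>Copies of a cube in a cube\<close>

lemma copy_eq_subcube:
  assumes S: "subgraph S (hypercube n)" "isomorphic S (hypercube l)" and v: "v \<in> verts S"
  obtains D where "D \<subseteq> {..<n}" "card D = l" "S = subcube v D"
proof -
  obtain g where g: "bij_betw g {u. length u = l} (verts S)"
    and g_edge: "\<And>u w. length u = l \<Longrightarrow> length w = l \<Longrightarrow>
      {u, w} \<in> edges (hypercube l) \<longleftrightarrow> {g u, g w} \<in> edges S"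
    using isomorphicE[OF S(2)] by (auto simp: hypercube_def)
  obtain u where u: "length u = l" "g u = v"
    using v bij_betw_imp_surj_on[OF g, symmetric] by auto
  have len_v: "length v = n" using S v by (auto simp: subgraph_def hypercube_def)
  have g_flip: "\<exists>j<n. g (flip w {i}) = flip (g w) {j}" if "length w = l" "i < l" for w i
  proof -
    have "{g w, g (flip w {i})} \<in> edges S"
      using that by (subst g_edge[symmetric]) (auto simp: edge_hypercube_iff)
    then have "{g w, g (flip w {i})} \<in> edges (hypercube n)"
      using S by (auto simp: subgraph_def)
    then show ?thesis by (auto simp: edge_hypercube_iff)
  qed
  have "\<forall>i. \<exists>j. i < l \<longrightarrow> j < n \<and> g (flip u {i}) = flip v {j}"
    using g_flip u by blast
  then obtain d where d: "\<And>i. i < l \<Longrightarrow> d i < n \<and> g (flip u {i}) = flip v {d i}"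
    by metis
  have g_inj: "g (flip u A) = g (flip u B) \<longleftrightarrow> A = B" if "A \<subseteq> {..<l}" "B \<subseteq> {..<l}" for A B
    using that g u inj_on_eq_iff[of g "{u. length u = l}" "flip u A" "flip u B"] flip_eq_iff[of A u B]
    by (auto simp: bij_betw_def)
  have d_inj: "inj_on d {..<l}"
  proof (rule inj_onI)
    fix i j assume "i \<in> {..<l}" "j \<in> {..<l}" "d i = d j"
    then show "i = j" using d g_inj[of "{i}" "{j}"] by auto
  qed
  have main: "g (flip u A) = flip v (d ` A)" if "A \<subseteq> {..<l}" for A
    using that
  proof (induction "card A" arbitrary: A rule: less_induct)
    case less
    have fin: "finite A" using less.prems finite_subset by blast
    show ?case
    proof (cases "\<exists>i j. i \<in> A \<and> j \<in> A \<and> i \<noteq> j")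
      case False
      then have "A = {} \<or> (\<exists>i. A = {i})" by blast
      then show ?thesis using d u less.prems by auto
    next
      case True
      then obtain i j where ij: "i \<in> A" "j \<in> A" "i \<noteq> j" by blast
      text \<open>Two vertices at distance 2 in a cube have exactly two common neighbours; one of them is
        already the image of \<open>A - {i, j}\<close>.\<close>
      have i: "g (flip u (A - {i})) = flip v (d ` (A - {i}))"
        using ij less.prems fin by (intro less.hyps psubset_card_mono) auto
      have j: "g (flip u (A - {j})) = flip v (d ` (A - {j}))"
        using ij less.prems fin by (intro less.hyps psubset_card_mono) auto
      have 0: "g (flip u (A - {i, j})) = flip v (d ` (A - {i, j}))"
        using ij less.prems fin by (intro less.hyps psubset_card_mono) auto
      have img: "d ` (A - X) = d ` A - d ` X" if "X \<subseteq> A" for X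
        using that less.prems by (intro inj_on_image_set_diff[OF d_inj]) auto
      have dij: "d i \<in> d ` A" "d j \<in> d ` A" "d i \<noteq> d j"
        using ij less.prems d_inj by (auto simp: inj_on_def)
      have dA: "d ` A \<subseteq> {..<n}" using d less.prems by auto
      obtain p where p: "p < n" "g (flip u A) = flip (g (flip u (A - {i}))) {p}"
      proof -
        have "flip (flip u (A - {i})) {i} = flip u A" using ij by (auto intro!: arg_cong[of _ _ "flip u"])
        then show ?thesis using g_flip[of "flip u (A - {i})" i] ij less.prems u that by auto
      qed
      obtain q where q: "q < n" "g (flip u A) = flip (g (flip u (A - {j}))) {q}"
      proof -
        have "flip (flip u (A - {j})) {j} = flip u A" using ij by (auto intro!: arg_cong[of _ _ "flip u"])
        then show ?thesis using g_flip[of "flip u (A - {j})" j] ij less.prems u that by auto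
      qed
      have p': "g (flip u A) = flip v (sym_diff (d ` A - {d i}) {p})"
        using p i img[of "{i}"] ij by simp
      have q': "g (flip u A) = flip v (sym_diff (d ` A - {d j}) {q})"
        using q j img[of "{j}"] ij by simp
      \<comment> \<open>If \<open>p = d j\<close>, then \<open>A\<close> and
        \<open>A - {i, j}\<close> would have the same image under the injective \<open>g\<close>.
        Otherwise \<open>d j\<close> lies in the set of \<open>p'\<close>, so comparison with
        \<open>q'\<close> forces \<open>q = d j\<close>, and then \<open>p = d i\<close>.\<close>
      have "g (flip u A) \<noteq> flip v (d ` A - {d i, d j})"
        using 0 img[of "{i, j}"] ij g_inj[of A "A - {i, j}"] less.prems by auto
      then have "p \<noteq> d j" using p' dij by (auto simp: insert_commute Diff_insert2[symmetric])
      moreover have "sym_diff (d ` A - {d i}) {p} = sym_diff (d ` A - {d j}) {q}"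
        using p'[symmetric] unfolding q' using len_v dA p q by (subst (asm) flip_eq_iff) auto
      ultimately have "p = d i" using dij by auto
      then have "sym_diff (d ` A - {d i}) {p} = d ` A" using dij by auto
      then show ?thesis using p' by simp
    qed
  qed
  define D where "D = d ` {..<l}"
  have cube: "{w. length w = l} = flip u ` Pow {..<l}"
    using flip_image_Pow[of u] u by simp
  have vS: "verts S = verts (subcube v D)"
  proof -
    have "verts S = g ` flip u ` Pow {..<l}"
      using g cube by (simp add: bij_betw_def)
    also have "\<dots> = flip v ` (`) d ` Pow {..<l}"
      using main by (auto simp: image_image)
    also have "(`) d ` Pow {..<l} = Pow D"
      by (simp add: D_def image_Pow_surj)
    finally show ?thesis by (simp add: verts_subcube)
  qed
  \<comment> \<open>Parallel edges go to parallel edges: the direction \<open>d i\<close> found at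
    \<open>u\<close> serves at every vertex. This makes the edges of \<open>S\<close> agree with
    those of the subcube.\<close>
  have flip_g: "g (flip w {i}) = flip (g w) {d i}" if "length w = l" "i < l" for w i
  proof -
    have "length w = length u" using that u by simp
    from ex_flip[OF this] obtain A where A: "A \<subseteq> {..<l}" "w = flip u A"
      using u by auto
    have "d ` (sym_diff A {i}) = sym_diff (d ` A) {d i}"
      using A that image_sym_diff[OF d_inj, of A "{i}"] by simp
    moreover have "sym_diff A {i} \<subseteq> {..<l}" using A that by auto
    ultimately show ?thesis using A by (simp add: main)
  qed
  have edge: "{y, z} \<in> edges S \<longleftrightarrow> {y, z} \<in> edges (subcube v D)"
    if "y \<in> verts S" "z \<in> verts S" for y z
  proof -
    have "y \<in> g ` {u. length u = l}" "z \<in> g ` {u. length u = l}"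
      using that bij_betw_imp_surj_on[OF g] by auto
    then obtain a b where ab: "length a = l" "length b = l" "y = g a" "z = g b"
      by blast
    have "{y, z} \<in> edges S \<longleftrightarrow> (\<exists>i<l. b = flip a {i})"
      using ab by (simp add: g_edge[symmetric] edge_hypercube_iff)
    also have "\<dots> \<longleftrightarrow> (\<exists>i<l. g b = g (flip a {i}))"
      using ab inj_on_eq_iff[OF bij_betw_imp_inj_on[OF g], of b] by simp
    also have "\<dots> \<longleftrightarrow> (\<exists>i<l. g b = flip (g a) {d i})"
      using ab flip_g by auto
    finally show ?thesis using ab that vS by (auto simp: edge_subcube_iff D_def)
  qed
  have D: "D \<subseteq> {..<n}" using d by (auto simp: D_def)
  have "simple_graph S" "simple_graph (subcube v D)"
    using S subgraph_subcube_hypercube[of D v] D len_v by (auto simp: subgraph_def)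
  then have "edges S = edges (subcube v D)"
  proof (intro subset_antisym subsetI)
    fix e assume "simple_graph S" "e \<in> edges S"
    then obtain y z where "y \<in> verts S" "z \<in> verts S" "e = {y, z}"
      unfolding simple_graph_def by blast
    with edge \<open>e \<in> edges S\<close> show "e \<in> edges (subcube v D)" by simp
  next
    fix e assume "simple_graph (subcube v D)" "e \<in> edges (subcube v D)"
    then obtain y z where "y \<in> verts S" "z \<in> verts S" "e = {y, z}"
      unfolding simple_graph_def vS by blast
    with edge \<open>e \<in> edges (subcube v D)\<close> show "e \<in> edges S" by simp
  qed
  moreover have "card D = l" using d_inj by (simp add: D_def card_image)
  ultimately show ?thesis using that[of D] D vS by (simp add: prod_eq_iff)
qed

definition cube_pairs :: "bool list graph \<Rightarrow> nat \<Rightarrow> nat \<Rightarrow> (bool list \<times> nat set) set" where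
  "cube_pairs G n l =
     {(v, D). length v = n \<and> D \<subseteq> {..<n} \<and> card D = l \<and> subgraph (subcube v D) G}"

text \<open>Double counting of incidences between copies and their vertices. Each copy has
  \<open>2 ^ l\<close> vertices, and by \<open>copy_eq_subcube\<close> and
  \<open>subcube_inject\<close> a copy with a marked vertex \<open>v\<close> corresponds to exactly
  one set of directions at \<open>v\<close>.\<close>

lemma num_copies_hypercube:
  assumes G: "subgraph G (hypercube n)"
  shows "num_copies G (hypercube l) * 2 ^ l = card (cube_pairs G n l)"
proof -
  have "bij_betw (\<lambda>(v, D). (subcube v D, v)) (cube_pairs G n l) (Sigma (copies G (hypercube l)) verts)"
    unfolding bij_betw_def
  proof (intro conjI subset_antisym subsetI)
    show "inj_on (\<lambda>(v, D). (subcube v D, v)) (cube_pairs G n l)"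
    proof (rule inj_onI)
      fix p q
      assume pq: "p \<in> cube_pairs G n l" "q \<in> cube_pairs G n l"
        and eq: "(\<lambda>(v, D). (subcube v D, v)) p = (\<lambda>(v, D). (subcube v D, v)) q"
      obtain v D w E where p: "p = (v, D)" and q: "q = (w, E)" by (cases p, cases q) auto
      have "w = v" "subcube v D = subcube v E" using eq p q by auto
      moreover have "D \<subseteq> {..<length v}" "E \<subseteq> {..<length w}"
        using pq p q by (auto simp: cube_pairs_def)
      ultimately show "p = q" using p q subcube_inject by blast
    qed
    fix p assume "p \<in> (\<lambda>(v, D). (subcube v D, v)) ` cube_pairs G n l"
    then obtain v D where p: "p = (subcube v D, v)"
      and v: "length v = n" "D \<subseteq> {..<n}" "card D = l" "subgraph (subcube v D) G"
      by (auto simp: cube_pairs_def)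
    have "v \<in> flip v ` Pow D" by (rule image_eqI[of _ _ "{}"]) simp_all
    then show "p \<in> Sigma (copies G (hypercube l)) verts"
      using p v subcube_isomorphic[of D v] by (simp add: copies_def verts_subcube)
  next
    fix p assume "p \<in> Sigma (copies G (hypercube l)) verts"
    then obtain S v where p: "p = (S, v)" "subgraph S G" "isomorphic S (hypercube l)" "v \<in> verts S"
      by (auto simp: copies_def)
    have S: "subgraph S (hypercube n)" using p G subgraph_trans by blast
    then have len: "length v = n" using p by (auto simp: subgraph_def hypercube_def)
    obtain D where "D \<subseteq> {..<n}" "card D = l" "S = subcube v D"
      using copy_eq_subcube[OF S p(3,4)] .
    then have "(v, D) \<in> cube_pairs G n l" "p = (subcube v D, v)"
      using len p by (auto simp: cube_pairs_def)
    then show "p \<in> (\<lambda>(v, D). (subcube v D, v)) ` cube_pairs G n l" by force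
  qed
  then have "card (cube_pairs G n l) = card (Sigma (copies G (hypercube l)) verts)"
    by (rule bij_betw_same_card)
  also have "\<dots> = (\<Sum>S\<in>copies G (hypercube l). card (verts S))"
  proof (rule card_SigmaI)
    have "simple_graph G" using G by (simp add: subgraph_def)
    then show "finite (copies G (hypercube l))"
      unfolding copies_def by (rule finite_subset[OF _ finite_subgraphs, rotated]) auto
  qed (auto simp: copies_def subgraph_def simple_graph_def)
  also have "\<dots> = (\<Sum>S\<in>copies G (hypercube l). 2 ^ l)"
  proof (rule sum.cong)
    fix S assume "S \<in> copies G (hypercube l)"
    then have "card (verts S) = card (verts (hypercube l))"
      by (auto simp: copies_def isomorphic_def dest: bij_betw_same_card)
    then show "card (verts S) = 2 ^ l" by (simp add: hypercube_def card_lists_length)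
  qed simp
  finally show ?thesis by (simp add: num_copies_def)
qed

lemma subgraph_refl: "simple_graph G \<Longrightarrow> subgraph G G"
  by (simp add: subgraph_def)

lemma num_copies_hypercube_hypercube:
  "num_copies (hypercube n) (hypercube l) * 2 ^ l = 2 ^ n * (n choose l)"
proof -
  have "cube_pairs (hypercube n) n l = {v. length v = n} \<times> {D. D \<subseteq> {..<n} \<and> card D = l}"
    using subgraph_subcube_hypercube by (auto simp: cube_pairs_def)
  then show ?thesis
    using num_copies_hypercube[OF subgraph_refl[OF simple_graph_hypercube], of n l]
    by (simp add: card_cartesian_product card_lists_length n_subsets)
qed

section \<open>Even cycles in the cube\<close>

abbreviation walk :: "'a graph \<Rightarrow> 'a list \<Rightarrow> bool" where
  "walk G \<equiv> successively (\<lambda>x y. {x, y} \<in> edges G)"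

text \<open>Lets a cycle be presented as a list: indexing into \<open>c\<close> is the isomorphism
  from \<open>cycle_graph m\<close> onto the subgraph \<open>S\<close> traced by the list.\<close>

lemma not_graph_free_cycle:
  assumes G: "simple_graph G" and c: "distinct c" "length c = m" "m \<ge> 3"
    and w: "walk G c" "{last c, hd c} \<in> edges G"
  shows "\<not> graph_free G (cycle_graph m)"
proof -
  define S where "S = (set c, {{c ! i, c ! ((i + 1) mod m)} |i. i < m})"
  have mod: "(i + 1) mod m < m \<and> i \<noteq> (i + 1) mod m" if "i < m" for i
    using that c(3) by (cases "i + 1 = m") auto
  \<comment> \<open>Only at the last index does \<open>mod\<close> wrap around, and there the pair
    is the closing edge.\<close>
  have "{c ! i, c ! ((i + 1) mod m)} \<in> edges G" if "i < m" for i
  proof (cases "Suc i = m")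
    case True
    then have "c ! i = last c" using c last_conv_nth[of c] by force
    moreover have "c ! ((i + 1) mod m) = hd c" using c True hd_conv_nth[of c] by force
    ultimately show ?thesis using w by simp
  next
    case False
    then have "Suc i < m" using that by simp
    then show ?thesis using w c by (simp add: successively_conv_nth)
  qed
  then have edge: "edges S \<subseteq> edges G" by (auto simp: S_def)
  have "\<exists>u\<in>verts S. \<exists>v\<in>verts S. u \<noteq> v \<and> e = {u, v}" if "e \<in> edges S" for e
  proof -
    obtain i where i: "i < m" "e = {c ! i, c ! ((i + 1) mod m)}"
      using \<open>e \<in> edges S\<close> by (auto simp: S_def)
    have "c ! i \<noteq> c ! ((i + 1) mod m)"
      using mod[OF i(1)] i(1) c by (simp add: nth_eq_iff_index_eq)
    moreover have "c ! i \<in> set c" "c ! ((i + 1) mod m) \<in> set c"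
      using mod[OF i(1)] i(1) c by auto
    ultimately show ?thesis using i(2) unfolding S_def fst_conv by blast
  qed
  then have "simple_graph S" by (simp add: simple_graph_def S_def)
  moreover have "verts S \<subseteq> verts G"
  proof
    \<comment> \<open>Every entry of \<open>c\<close> is an end of an edge of \<open>G\<close>, so
      it is a vertex of \<open>G\<close>.\<close>
    fix x assume "x \<in> verts S"
    then obtain i where i: "i < m" "x = c ! i"
      using c by (auto simp: S_def in_set_conv_nth)
    then have "{x, c ! ((i + 1) mod m)} \<in> edges G" using edge by (auto simp: S_def)
    then obtain a b where "a \<in> verts G" "b \<in> verts G" "{x, c ! ((i + 1) mod m)} = {a, b}"
      using G unfolding simple_graph_def by blast
    then show "x \<in> verts G" by (auto simp only: doubleton_eq_iff)
  qed
  ultimately have sub: "subgraph S G" using edge by (simp add: subgraph_def)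
  have "isomorphic S (cycle_graph m)"
  proof (rule isomorphicI[of "(!) c"])
    show "bij_betw ((!) c) (verts (cycle_graph m)) (verts S)"
      using c by (auto simp: cycle_graph_def S_def intro: bij_betw_nth)
    fix u v assume "u \<in> verts (cycle_graph m)" "v \<in> verts (cycle_graph m)"
    then have uv: "u < m" "v < m" by (auto simp: cycle_graph_def)
    have "{u, v} = {i, (i + 1) mod m} \<longleftrightarrow> {c ! u, c ! v} = {c ! i, c ! ((i + 1) mod m)}"
      if "i < m" for i
      using that uv mod[OF that] c unfolding doubleton_eq_iff by (simp add: nth_eq_iff_index_eq)
    then show "{u, v} \<in> edges (cycle_graph m) \<longleftrightarrow> {c ! u, c ! v} \<in> edges S"
      unfolding cycle_graph_def S_def snd_conv mem_Collect_eq by blast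
  qed
  with sub show ?thesis unfolding graph_free_def by blast
qed

lemma edge_hypercube_Cons:
  assumes "{x, y} \<in> edges (hypercube l)"
  shows "{b # x, b # y} \<in> edges (hypercube (Suc l))"
proof -
  obtain i where "length x = l" "i < l" "y = flip x {i}"
    using assms by (auto simp: edge_hypercube_iff)
  moreover have "b # flip x {i} = flip (b # x) {Suc i}"
    by (auto simp: list_eq_iff_nth_eq nth_Cons split: nat.split)
  ultimately show ?thesis by (auto simp: edge_hypercube_iff)
qed

lemma edge_hypercube_hd:
  assumes "length x = l" "a \<noteq> b"
  shows "{a # x, b # x} \<in> edges (hypercube (Suc l))"
proof -
  have "b # x = flip (a # x) {0}"
    using assms by (auto simp: list_eq_iff_nth_eq nth_Cons split: nat.split)
  then show ?thesis using assms(1) by (auto simp: edge_hypercube_iff)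
qed

text \<open>Walk along \<open>p\<close> in one facet, cross to the opposite facet, return along the
  translate of \<open>p\<close> and cross back. The open walk serves for the Gray code, the closed
  one for even cycles.\<close>

lemma walk_prism:
  assumes "walk (hypercube l) p" "p \<noteq> []" "set p \<subseteq> {x. length x = l}"
  defines "c \<equiv> map (Cons False) p @ map (Cons True) (rev p)"
  shows "walk (hypercube (Suc l)) c" "{last c, hd c} \<in> edges (hypercube (Suc l))"
proof -
  have 1: "walk (hypercube (Suc l)) (map (Cons b) q)" if "walk (hypercube l) q" for b q
    using that unfolding successively_map
    by (rule successively_mono) (auto intro: edge_hypercube_Cons)
  have "walk (hypercube l) (rev p)"
    using assms(1) by (simp add: insert_commute)
  then show "walk (hypercube (Suc l)) c"
    using 1 assms(1,2) edge_hypercube_hd[of "last p" l False True] last_in_set[of p] assms(3)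
    unfolding subset_iff by (auto simp: c_def successively_append_iff last_map hd_map hd_rev simp del: successively_rev)
  show "{last c, hd c} \<in> edges (hypercube (Suc l))"
    using assms(2) edge_hypercube_hd[of "hd p" l True False] hd_in_set[of p] assms(3)
    unfolding subset_iff by (auto simp: c_def last_map hd_map last_rev)
qed

text \<open>The induction builds the reflected Gray code.\<close>

lemma hypercube_hamiltonian_path:
  "\<exists>p. distinct p \<and> length p = 2 ^ l \<and> set p \<subseteq> {x. length x = l} \<and> walk (hypercube l) p"
proof (induction l)
  case 0
  show ?case by (intro exI[of _ "[[]]"]) simp
next
  case (Suc l)
  then obtain p where p: "distinct p" "length p = 2 ^ l" "set p \<subseteq> {x. length x = l}"
    "walk (hypercube l) p" by blast
  then have "p \<noteq> []" by auto
  then show ?case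
    using p walk_prism(1)[of l p]
    by (intro exI[of _ "map (Cons False) p @ map (Cons True) (rev p)"]) (auto simp: distinct_map)
qed

lemma hypercube_even_cycle:
  assumes "k \<ge> 2" "2 * k \<le> 2 ^ l"
  obtains c where "distinct c" "length c = 2 * k" "set c \<subseteq> {x. length x = l}"
    "walk (hypercube l) c" "{last c, hd c} \<in> edges (hypercube l)"
proof -
  obtain l' where l: "l = Suc l'" using assms by (cases l) auto
  obtain p where p: "distinct p" "length p = 2 ^ l'" "set p \<subseteq> {x. length x = l'}"
    "walk (hypercube l') p" using hypercube_hamiltonian_path by blast
  \<comment> \<open>\<open>p\<close> has \<open>2 ^ l'\<close> entries, and
    \<open>2 * k \<le> 2 * 2 ^ l'\<close>, so this prefix really has \<open>k\<close> entries and
    its prism gives a cycle of length \<open>2 * k\<close>.\<close>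
  define q where "q = take k p"
  have "walk (hypercube l') (q @ drop k p)" using p by (simp add: q_def)
  then have "walk (hypercube l') q" by (simp only: successively_append_iff)
  moreover have q: "distinct q" "length q = k" "set q \<subseteq> {x. length x = l'}"
    using p assms l set_take_subset[of k p] by (auto simp: q_def)
  moreover have "q \<noteq> []" using q assms by auto
  ultimately show ?thesis
    using walk_prism[of l' q]
    by (intro that[of "map (Cons False) q @ map (Cons True) (rev q)"]) (auto simp: l distinct_map)
qed

section \<open>Large cubes contain the forbidden cycle\<close>

lemma graph_free_subgraph:
  "graph_free G H \<Longrightarrow> subgraph S G \<Longrightarrow> graph_free S H"
  unfolding graph_free_def by (meson subgraph_trans)

lemma copies_hypercube_empty:
  assumes "graph_free G (cycle_graph (2 * k))" "k \<ge> 2" "2 * k \<le> 2 ^ l"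
  shows "copies G (hypercube l) = {}"
proof (rule ccontr)
  assume "copies G (hypercube l) \<noteq> {}"
  then obtain S where S: "subgraph S G" "isomorphic S (hypercube l)"
    by (auto simp: copies_def)
  obtain h where h: "bij_betw h {x. length x = l} (verts S)"
    "\<And>u v. length u = l \<Longrightarrow> length v = l \<Longrightarrow>
      {u, v} \<in> edges (hypercube l) \<longleftrightarrow> {h u, h v} \<in> edges S"
    using isomorphicE[OF S(2)] by (auto simp: hypercube_def)
  obtain c where c: "distinct c" "length c = 2 * k" "set c \<subseteq> {x. length x = l}"
    "walk (hypercube l) c" "{last c, hd c} \<in> edges (hypercube l)"
    by (rule hypercube_even_cycle[OF assms(2,3)])
  have "c \<noteq> []" using c assms by auto
  have "walk S (map h c)"
    unfolding successively_map using c(4)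
    by (rule successively_mono) (use c h in auto)
  moreover have "{last (map h c), hd (map h c)} \<in> edges S"
    using c h(2)[of "last c" "hd c"] \<open>c \<noteq> []\<close> by (auto simp: last_map hd_map subset_iff)
  moreover have "distinct (map h c)"
    using c h by (auto simp: distinct_map bij_betw_def intro: inj_on_subset)
  moreover have "simple_graph S" using S by (simp add: subgraph_def)
  ultimately have "\<not> graph_free S (cycle_graph (2 * k))"
    using c assms by (intro not_graph_free_cycle[of S "map h c"]) auto
  then show False using graph_free_subgraph assms(1) S(1) by blast
qed

lemma ex_density_hypercube_eq_0:
  assumes "k \<ge> 2" "2 * k \<le> 2 ^ l"
  shows "ex_density (hypercube n) (hypercube l) (cycle_graph (2 * k)) = 0"
proof -
  let ?N = "{num_copies G (hypercube l) |G. subgraph G (hypercube n) \<and> graph_free G (cycle_graph (2 * k))}"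
  \<comment> \<open>Nonemptiness matters: \<open>Max\<close> of the empty set would carry no
    information.\<close>
  have "?N \<noteq> {}" using assms by (intro ex_num_set_nonempty) (simp add: cycle_graph_def lessThan_empty_iff)
  moreover have "?N \<subseteq> {0}"
  proof
    fix N assume "N \<in> ?N"
    then obtain G where G: "N = num_copies G (hypercube l)"
      "subgraph G (hypercube n)" "graph_free G (cycle_graph (2 * k))"
      by blast
    then show "N \<in> {0}" using copies_hypercube_empty[OF G(3) assms] by (simp add: num_copies_def)
  qed
  ultimately have "?N = {0}" by (simp only: subset_singleton_iff) simp
  then show ?thesis by (simp add: ex_density_def ex_num_def)
qed

section \<open>Squares at a vertex\<close>

text \<open>Ordered pairs are counted, so the threshold amounts to an average degree above
  \<open>2 * k\<close>. Deleting a vertex of degree below \<open>k\<close> preserves the hypothesis;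
  once all degrees are at least \<open>k\<close>, a path can be extended greedily until it has
  \<open>k\<close> vertices.\<close>

lemma path_of_many_pairs:
  fixes R :: "'a \<Rightarrow> 'a \<Rightarrow> bool"
  assumes "finite V" and sym: "\<And>a b. R a b \<Longrightarrow> R b a" and "k \<ge> 1"
    and "2 * k * card V < card {(a, b) \<in> V \<times> V. R a b}"
  shows "\<exists>p. distinct p \<and> set p \<subseteq> V \<and> length p = k \<and> successively R p"
  using assms(1,4)
proof (induction V rule: finite_psubset_induct)
  case (psubset V)
  define N where "N a = {b \<in> V. R a b}" for a
  have finN: "finite (N a)" for a using psubset.hyps by (simp add: N_def)
  show ?case
  proof (cases "\<exists>a\<in>V. card (N a) < k")
    case True
    then obtain a where a: "a \<in> V" "card (N a) < k" by blast
    let ?W = "V - {a}"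
    have fin: "finite {(x, y) \<in> ?W \<times> ?W. R x y}"
      using psubset.hyps by (auto intro: finite_subset[of _ "V \<times> V"])
    \<comment> \<open>The pairs lost with \<open>a\<close> have \<open>a\<close> as first or second
      entry, hence number at most \<open>2 * k\<close>, which is what the threshold drops when
      \<open>V\<close> loses one vertex.\<close>
    have "{(x, y) \<in> V \<times> V. R x y} \<subseteq> {(x, y) \<in> ?W \<times> ?W. R x y} \<union> ({a} \<times> N a \<union> N a \<times> {a})"
      using sym by (auto simp: N_def)
    then have "card {(x, y) \<in> V \<times> V. R x y} \<le>
        card ({(x, y) \<in> ?W \<times> ?W. R x y} \<union> ({a} \<times> N a \<union> N a \<times> {a}))"
      using finN fin by (intro card_mono) auto
    also have "\<dots> \<le> card {(x, y) \<in> ?W \<times> ?W. R x y} + (card ({a} \<times> N a) + card (N a \<times> {a}))"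
      by (intro order_trans[OF card_Un_le] add_left_mono card_Un_le)
    also have "\<dots> \<le> card {(x, y) \<in> ?W \<times> ?W. R x y} + 2 * k"
      using a by (simp add: card_cartesian_product)
    finally have "2 * k * card V < card {(x, y) \<in> ?W \<times> ?W. R x y} + 2 * k"
      using psubset.prems by simp
    moreover have "card V = Suc (card ?W)"
      using card.remove[OF psubset.hyps(1) a(1)] .
    ultimately have "2 * k * card ?W < card {(x, y) \<in> ?W \<times> ?W. R x y}" by simp
    then have "\<exists>p. distinct p \<and> set p \<subseteq> ?W \<and> length p = k \<and> successively R p"
      using a by (intro psubset.IH) auto
    then show ?thesis by blast
  next
    case False
    have "V \<noteq> {}" using psubset.prems by auto
    have "\<exists>p. distinct p \<and> set p \<subseteq> V \<and> length p = Suc j \<and> successively R p" if "j < k" for j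
      using that
    proof (induction j)
      case 0
      obtain a where "a \<in> V" using \<open>V \<noteq> {}\<close> by blast
      then show ?case by (intro exI[of _ "[a]"]) auto
    next
      case (Suc j)
      then obtain p where p: "distinct p" "set p \<subseteq> V" "length p = Suc j" "successively R p"
        by auto
      then obtain a q where q: "p = a # q" by (cases p) auto
      \<comment> \<open>The head \<open>a\<close> has at least \<open>k\<close> neighbours while the
        path has fewer than \<open>k\<close> vertices, so some neighbour can be put in
        front.\<close>
      have "k \<le> card (N a)" using False p q by auto
      moreover have "card (set p) < k" using p Suc.prems by (simp add: distinct_card)
      ultimately have "\<not> N a \<subseteq> set p" using card_mono[of "set p" "N a"] by auto
      then obtain b where "b \<in> V" "R a b" "b \<notin> set p" by (auto simp: N_def)
      then show ?case using p q sym by (intro exI[of _ "b # p"]) auto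
    qed
    from this[of "k - 1"] show ?thesis using \<open>k \<ge> 1\<close> by simp
  qed
qed

text \<open>The offsets from \<open>v\<close> of the remaining vertices of the intended cycle:
  singletons alternate with pairs of consecutive directions, so neighbouring sets differ in one
  direction.\<close>

fun zigzag :: "'a list \<Rightarrow> 'a set list" where
  "zigzag [] = []"
| "zigzag [a] = [{a}]"
| "zigzag (a # b # xs) = {a} # {a, b} # zigzag (b # xs)"

lemma length_zigzag: "length (zigzag xs) = 2 * length xs - 1"
  by (induction xs rule: zigzag.induct) auto

lemma zigzag_subset: "A \<in> set (zigzag xs) \<Longrightarrow> A \<noteq> {} \<and> A \<subseteq> set xs"
  by (induction xs rule: zigzag.induct) auto

text \<open>The first two sets contain \<open>a\<close>, while all later ones consist of later
  entries of the list.\<close>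

lemma distinct_zigzag: "distinct xs \<Longrightarrow> distinct (zigzag xs)"
  by (induction xs rule: zigzag.induct) (auto dest: zigzag_subset)

text \<open>Exposes the first set whether or not the tail is empty, so that a walk can be continued
  into the recursive part.\<close>

lemma zigzag_Cons: "zigzag (a # xs) = {a} # tl (zigzag (a # xs))"
  by (cases xs) auto

lemma last_zigzag: "xs \<noteq> [] \<Longrightarrow> last (zigzag xs) = {last xs}"
proof (induction xs rule: zigzag.induct)
  case (3 a b xs)
  then show ?case using zigzag_Cons[of b xs] by (metis last_ConsR list.discI zigzag.simps(3))
qed auto

text \<open>Adjacency of the directions \<open>a\<close> and \<open>b\<close> in the auxiliary graph
  at \<open>v\<close>.\<close>

definition square :: "bool list graph \<Rightarrow> bool list \<Rightarrow> nat \<Rightarrow> nat \<Rightarrow> bool" where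
  "square G v a b \<longleftrightarrow> a \<noteq> b \<and> {v, flip v {a}} \<in> edges G \<and> {v, flip v {b}} \<in> edges G \<and>
     {flip v {a}, flip v {a, b}} \<in> edges G \<and> {flip v {b}, flip v {a, b}} \<in> edges G"

lemma square_sym: "square G v a b \<Longrightarrow> square G v b a"
  by (auto simp: square_def insert_commute)

text \<open>Each square supplies the two edges through its corner opposite to \<open>v\<close>. The
  edges at \<open>v\<close> itself are reserved for closing the cycle.\<close>

lemma walk_zigzag:
  "successively (square G v) xs \<Longrightarrow> walk G (map (flip v) (zigzag xs))"
proof (induction xs rule: zigzag.induct)
  case (3 a b xs)
  then have sq: "square G v a b" and IH: "walk G (map (flip v) (zigzag (b # xs)))" by auto
  have "{flip v {a, b}, flip v {b}} \<in> edges G"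
    using sq by (simp add: square_def insert_commute[of "flip v {b}"])
  with IH sq show ?case
    by (subst zigzag.simps(3), subst zigzag_Cons, subst (asm) zigzag_Cons)
      (simp add: square_def)
qed auto

lemma card_square_le:
  assumes G: "subgraph G (hypercube n)" "graph_free G (cycle_graph (2 * k))"
    and k: "k \<ge> 2" and v: "length v = n"
  shows "card {(a, b) \<in> {..<n} \<times> {..<n}. square G v a b} \<le> 2 * k * n"
proof (rule ccontr)
  assume "\<not> ?thesis"
  then have "\<exists>p. distinct p \<and> set p \<subseteq> {..<n} \<and> length p = k \<and> successively (square G v) p"
    using k square_sym by (intro path_of_many_pairs) auto
  then obtain p where p: "distinct p" "set p \<subseteq> {..<n}" "length p = k"
    "successively (square G v) p" by blast
  obtain a b q where q: "p = a # b # q" using p k by (cases p rule: zigzag.cases) auto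
  have sq: "square G v a b" using p q by simp
  \<comment> \<open>As \<open>p\<close> has at least two entries, its last direction lies in a
    square, which contains the closing edge back to \<open>v\<close>.\<close>
  have "\<exists>c. square G v (last p) c"
  proof -
    have "\<exists>r. p = r @ [last (butlast p), last p]"
      using q by (metis append_butlast_last_id append_Cons append_assoc append_Nil butlast.simps(2) list.distinct(1))
    then obtain r where "p = r @ [last (butlast p), last p]" ..
    then have "square G v (last (butlast p)) (last p)"
      using p(4) by (metis successively.simps(3) successively_append_iff)
    then show ?thesis using square_sym by blast
  qed
  then have last: "{flip v {last p}, v} \<in> edges G"
    by (auto simp: square_def insert_commute)
  \<comment> \<open>The empty offset is \<open>v\<close> itself; with the \<open>2 * k - 1\<close>
    sets of \<open>zigzag p\<close> this makes \<open>2 * k\<close> vertices.\<close>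
  define c where "c = map (flip v) ({} # zigzag p)"
  have "{} \<notin> set (zigzag p)" using zigzag_subset by blast
  moreover have "set ({} # zigzag p) \<subseteq> Pow {..<n}" using zigzag_subset p by fastforce
  then have "inj_on (flip v) (set ({} # zigzag p))"
    using inj_on_flip[of v] v inj_on_subset by blast
  ultimately have "distinct c"
    unfolding c_def distinct_map using p by (simp add: distinct_zigzag)
  moreover have "length c = 2 * k" using k p by (simp add: c_def length_zigzag)
  moreover have "walk G c"
    using walk_zigzag[OF p(4)] sq unfolding c_def q by (simp add: square_def)
  moreover have "{last c, hd c} \<in> edges G"
  proof -
    have "zigzag p \<noteq> []" "p \<noteq> []" using q by auto
    then have "last c = flip v {last p}" using last_zigzag[of p] by (simp add: c_def last_map)
    then show ?thesis using last by (simp add: c_def)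
  qed
  ultimately have "\<not> graph_free G (cycle_graph (2 * k))"
    using G k by (intro not_graph_free_cycle) (auto simp: subgraph_def)
  then show False using G by blast
qed

text \<open>For a fixed vertex, a subcube in \<open>G\<close> is obtained from an ordered pair of
  directions spanning a square and a choice of the other \<open>l - 2\<close> directions. Counting
  these choices bounds the number of subcubes, with overcounting.\<close>

lemma card_cube_pairs_le:
  assumes G: "subgraph G (hypercube n)" "graph_free G (cycle_graph (2 * k))"
    and k: "k \<ge> 2" and l: "l \<ge> 2"
  shows "card (cube_pairs G n l) \<le> 2 ^ n * (2 * k * n * ((n - 2) choose (l - 2)))"
proof -
  define Ds where "Ds v = {D. D \<subseteq> {..<n} \<and> card D = l \<and> subgraph (subcube v D) G}" for v
  have le: "card (Ds v) \<le> 2 * k * n * ((n - 2) choose (l - 2))" if v: "length v = n" for v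
  proof -
    define P where "P = {(a, b) \<in> {..<n} \<times> {..<n}. square G v a b}"
    define Q where "Q = (\<lambda>(a, b). {E. E \<subseteq> {..<n} - {a, b} \<and> card E = l - 2})"
    have finP: "finite P" by (auto simp: P_def intro: finite_subset[of _ "{..<n} \<times> {..<n}"])
    have finQ: "finite (Q p)" for p
      by (auto simp: Q_def split: prod.split intro: finite_subset[of _ "Pow {..<n}"])
    have cardQ: "card (Q p) = (n - 2) choose (l - 2)" if "p \<in> P" for p
    proof -
      obtain a b where p: "p = (a, b)" "a < n" "b < n" "a \<noteq> b"
        using \<open>p \<in> P\<close> by (auto simp: P_def square_def)
      then have "card ({..<n} - {a, b}) = n - 2" by (simp add: card_Diff_subset)
      then show ?thesis using p n_subsets[of "{..<n} - {a, b}" "l - 2"] by (simp add: Q_def)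
    qed
    have "Ds v \<subseteq> (\<lambda>((a, b), E). insert a (insert b E)) ` Sigma P Q"
    proof
      fix D assume "D \<in> Ds v"
      then have D: "D \<subseteq> {..<n}" "card D = l" "subgraph (subcube v D) G" by (auto simp: Ds_def)
      have fin: "finite D" using D finite_subset by blast
      have "D \<noteq> {}" using D l by auto
      then obtain a where a: "a \<in> D" by blast
      have "card (D - {a}) \<noteq> 0" using a D l fin by simp
      then have "D - {a} \<noteq> {}" by (metis card.empty)
      then obtain b where b: "b \<in> D" "b \<noteq> a" by blast
      \<comment> \<open>The four instances used below are the sides of the 4-cycle at
        \<open>v\<close> in directions \<open>a\<close> and \<open>b\<close>.\<close>
      have "{flip v A, flip v (sym_diff A {i})} \<in> edges G" if "A \<subseteq> D" "i \<in> D" for A i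
      proof -
        have "{flip v A, flip v (sym_diff A {i})} \<in> edges (subcube v D)"
          using that by (auto simp: edge_subcube_iff verts_subcube)
        then show ?thesis using D by (auto simp: subgraph_def)
      qed
      from this[of "{}" a] this[of "{}" b] this[of "{a}" b] this[of "{b}" a]
      have "square G v a b"
        using a b by (simp add: square_def insert_Diff_if insert_commute)
      then have "(a, b) \<in> P" using a b D by (auto simp: P_def)
      moreover have "D - {a, b} \<in> Q (a, b)"
        using a b D l fin by (auto simp: Q_def card_Diff_subset)
      moreover have "D = insert a (insert b (D - {a, b}))" using a b by auto
      ultimately show "D \<in> (\<lambda>((a, b), E). insert a (insert b E)) ` Sigma P Q"
        by (intro image_eqI[of _ _ "((a, b), D - {a, b})"]) auto
    qed
    then have "card (Ds v) \<le> card (Sigma P Q)"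
      using finP finQ by (intro surj_card_le finite_SigmaI)
    also have "\<dots> = card P * ((n - 2) choose (l - 2))"
      using finP finQ cardQ by (simp add: card_SigmaI)
    also have "\<dots> \<le> 2 * k * n * ((n - 2) choose (l - 2))"
      using card_square_le[OF G k v] by (simp add: P_def)
    finally show ?thesis .
  qed
  have "cube_pairs G n l = Sigma {v. length v = n} Ds"
    by (auto simp: cube_pairs_def Ds_def)
  moreover have "finite {v :: bool list. length v = n}"
    by (rule finite_lists_length)
  moreover have "finite (Ds v)" for v
    by (auto simp: Ds_def intro: finite_subset[of _ "Pow {..<n}"])
  ultimately have "card (cube_pairs G n l) = (\<Sum>v | length v = n. card (Ds v))"
    by (simp add: card_SigmaI)
  also have "\<dots> \<le> (\<Sum>v :: bool list | length v = n. 2 * k * n * ((n - 2) choose (l - 2)))"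
    using le by (intro sum_mono) simp
  finally show ?thesis by (simp add: card_lists_length)
qed

section \<open>From counts of pairs to density bounds\<close>

lemma ex_num_eq:
  assumes "simple_graph G" "verts H \<noteq> {}"
  obtains G' where "subgraph G' G" "graph_free G' H" "ex_num G T H = num_copies G' T"
  using Max_in[OF finite_ex_num_set[OF assms(1), of T H] ex_num_set_nonempty[OF assms(2)]]
  by (auto simp: ex_num_def)

lemma num_copies_le_ex_num:
  assumes "simple_graph G" "subgraph G' G" "graph_free G' H"
  shows "num_copies G' T \<le> ex_num G T H"
  unfolding ex_num_def using assms by (intro Max_ge finite_ex_num_set) blast+

lemma ex_density_hypercube:
  "ex_density (hypercube n) (hypercube l) H =
     real (ex_num (hypercube n) (hypercube l) H * 2 ^ l) / (2 ^ n * real (n choose l))"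
proof -
  have "real (num_copies (hypercube n) (hypercube l)) * 2 ^ l = 2 ^ n * real (n choose l)"
    using arg_cong[OF num_copies_hypercube_hypercube[of n l], of real] by simp
  then show ?thesis by (simp add: ex_density_def flip: \<open>_ = 2 ^ n * real (n choose l)\<close>)
qed

text \<open>The ratio of \<open>(n - 2) choose (l - 2)\<close> to \<open>n choose l\<close> is
  \<open>l * (l - 1) / (n * (n - 1))\<close>. One factor of order \<open>n\<close> is cancelled by
  the linear bound on squares, the other remains.\<close>

lemma ex_density_hypercube_le:
  assumes k: "k \<ge> 2" and l: "2 \<le> l" "l \<le> n"
  shows "ex_density (hypercube n) (hypercube l) (cycle_graph (2 * k)) \<le> 4 * real k * real l ^ 2 / real n"
proof -
  let ?H = "cycle_graph (2 * k)"
  have "verts ?H \<noteq> {}" using k by (simp add: cycle_graph_def lessThan_empty_iff)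
  then obtain G where G: "subgraph G (hypercube n)" "graph_free G ?H"
    "ex_num (hypercube n) (hypercube l) ?H = num_copies G (hypercube l)"
    using ex_num_eq[OF simple_graph_hypercube] by metis
  define B where "B = real ((n - 2) choose (l - 2))"
  have "ex_num (hypercube n) (hypercube l) ?H * 2 ^ l \<le> 2 ^ n * (2 * k * n * ((n - 2) choose (l - 2)))"
    using card_cube_pairs_le[OF G(1,2) k l(1)] num_copies_hypercube[OF G(1)] G(3) by simp
  then have "real (ex_num (hypercube n) (hypercube l) ?H * 2 ^ l) \<le>
      real (2 ^ n * (2 * k * n * ((n - 2) choose (l - 2))))"
    by (simp only: of_nat_le_iff)
  then have 1: "ex_density (hypercube n) (hypercube l) ?H \<le>
      2 ^ n * (2 * real k * real n * B) / (2 ^ n * real (n choose l))"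
    unfolding ex_density_hypercube by (intro divide_right_mono) (simp_all add: B_def)
  \<comment> \<open>The absorption identity, applied twice.\<close>
  have "l * (n choose l) = n * ((n - 1) choose (l - 1))"
    "(l - 1) * ((n - 1) choose (l - 1)) = (n - 1) * ((n - 2) choose (l - 2))"
    using l times_binomial_minus1_eq[of l n] times_binomial_minus1_eq[of "l - 1" "n - 1"]
    by (auto simp: numeral_2_eq_2)
  then have "l * (l - 1) * (n choose l) = n * (n - 1) * ((n - 2) choose (l - 2))"
    by (metis mult.assoc mult.left_commute)
  then have "real (l * (l - 1) * (n choose l)) = real (n * (n - 1) * ((n - 2) choose (l - 2)))"
    by (simp only:)
  then have 2: "real l * (real l - 1) * real (n choose l) = real n * (real n - 1) * B"
    using l by (simp add: B_def of_nat_diff)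
  have pos: "real (n choose l) > 0" "real n - 1 > 0" "real n > 0" using l by auto
  have "2 ^ n * (2 * real k * real n * B) / (2 ^ n * real (n choose l)) =
      2 * real k * (real n * B) / real (n choose l)" by simp
  also have "real n * B = real l * (real l - 1) * real (n choose l) / (real n - 1)"
    using 2 pos by (simp add: field_simps)
  also have "2 * real k * \<dots> / real (n choose l) = 2 * real k * (real l * (real l - 1)) / (real n - 1)"
    using pos by simp
  \<comment> \<open>\<open>n - 1\<close> is at least \<open>n / 2\<close> because \<open>n\<close>
    is at least 2; this turns the factor 2 into 4.\<close>
  also have "\<dots> \<le> 2 * real k * (real l ^ 2) / (real n / 2)"
    using l by (intro frac_le mult_left_mono) (auto simp: power2_eq_square algebra_simps)
  finally show ?thesis using 1 by simp
qed

lemma ex_density_hypercube_ge: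
  assumes m: "m \<le> n" "2 ^ m < 2 * k"
  shows "real (m choose l) / real (n choose l) \<le>
    ex_density (hypercube n) (hypercube l) (cycle_graph (2 * k))"
proof -
  let ?H = "cycle_graph (2 * k)"
  \<comment> \<open>Only the first \<open>m\<close> directions are kept, so \<open>drop m\<close>
    labels the components, each a copy of \<open>hypercube m\<close>.\<close>
  define G :: "bool list graph" where "G = ({x. length x = n}, {{x, flip x {i}} |x i. length x = n \<and> i < m})"
  have "edges G \<subseteq> edges (hypercube n)"
  proof
    fix e assume "e \<in> edges G"
    then obtain x i where "e = {x, flip x {i}}" "length x = n" "i < m" by (auto simp: G_def)
    moreover from this have "i < n" using m by simp
    ultimately show "e \<in> edges (hypercube n)" by (auto simp: edge_hypercube_iff)
  qed
  moreover have "verts G = verts (hypercube n)" by (simp add: G_def hypercube_def)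
  ultimately have G: "subgraph G (hypercube n)"
    using simple_graph_hypercube[of n] unfolding subgraph_def simple_graph_def
    by (metis order_refl subsetD)
  have drop_eq: "drop m x = drop m y" if "{x, y} \<in> edges G" for x y
  proof -
    obtain z i where z: "{x, y} = {z, flip z {i}}" "length z = n" "i < m"
      using \<open>{x, y} \<in> edges G\<close> by (auto simp: G_def)
    then have "drop m (flip z {i}) = drop m z" by (auto simp: list_eq_iff_nth_eq)
    then show ?thesis using z by (auto simp: doubleton_eq_iff)
  qed
  have free: "graph_free G ?H"
    unfolding graph_free_def
  proof
    assume "\<exists>S. subgraph S G \<and> isomorphic S ?H"
    then obtain S where S: "subgraph S G" "isomorphic S ?H" by blast
    obtain h where h: "bij_betw h {..<2 * k} (verts S)"
      and h_edge: "\<And>u v. u < 2 * k \<Longrightarrow> v < 2 * k \<Longrightarrow> {u, v} \<in> edges ?H \<longleftrightarrow> {h u, h v} \<in> edges S"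
      using isomorphicE[OF S(2)] by (auto simp: cycle_graph_def)
    have "drop m (h i) = drop m (h 0)" if "i < 2 * k" for i
      using that
    proof (induction i)
      case (Suc i)
      then have "{i, Suc i} \<in> edges ?H"
        by (auto simp: cycle_graph_def intro!: exI[of _ i])
      then have "{h i, h (Suc i)} \<in> edges G"
        using h_edge Suc.prems S by (auto simp: subgraph_def)
      then show ?case using drop_eq Suc by fastforce
    qed simp
    then have eq: "drop m x = drop m (h 0)" if "x \<in> verts S" for x
      using that unfolding bij_betw_imp_surj_on[OF h, symmetric] by auto
    have len: "length x = n" if "x \<in> verts S" for x
      using that S by (auto simp: subgraph_def G_def)
    \<comment> \<open>All vertices of the cycle share the same \<open>drop m\<close>, so they are
      told apart by their first \<open>m\<close> coordinates and there are at most
      \<open>2 ^ m\<close> of them.\<close>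
    have "inj_on (take m) (verts S)"
      by (rule inj_onI) (metis append_take_drop_id eq)
    moreover have "take m ` verts S \<subseteq> {x. length x = m}" using len m by auto
    moreover have "finite {x :: bool list. length x = m}"
      by (rule finite_lists_length)
    ultimately have "card (verts S) \<le> card {x :: bool list. length x = m}"
      by (rule card_inj_on_le)
    then have "2 * k \<le> 2 ^ m"
      using bij_betw_same_card[OF h] by (simp add: card_lists_length)
    then show False using m by simp
  qed
  \<comment> \<open>Any vertex together with any \<open>l\<close> of the first \<open>m\<close>
    directions gives a subcube of \<open>G\<close>.\<close>
  have "{v. length v = n} \<times> {D. D \<subseteq> {..<m} \<and> card D = l} \<subseteq> cube_pairs G n l"
  proof clarify
    fix v :: "bool list" and D assume v: "n = length v" and D: "D \<subseteq> {..<m}" "l = card D"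
    have Dn: "D \<subseteq> {..<length v}" using D m v by auto
    have "edges (subcube v D) \<subseteq> edges G"
      using D v by (fastforce simp: subcube_def G_def)
    then have "subgraph (subcube v D) G"
      using subgraph_subcube_hypercube[OF Dn] v by (auto simp: subgraph_def G_def hypercube_def)
    then show "(v, D) \<in> cube_pairs G (length v) (card D)"
      using Dn by (simp add: cube_pairs_def)
  qed
  moreover have "finite (cube_pairs G n l)"
    using finite_lists_length[of n]
    by (auto simp: cube_pairs_def intro: finite_subset[of _ "{v. length v = n} \<times> Pow {..<n}"])
  ultimately have "card ({v :: bool list. length v = n} \<times> {D. D \<subseteq> {..<m} \<and> card D = l}) \<le>
      card (cube_pairs G n l)"
    by (intro card_mono)
  then have "2 ^ n * (m choose l) \<le> card (cube_pairs G n l)"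
    by (simp add: card_cartesian_product card_lists_length n_subsets)
  also have "\<dots> = num_copies G (hypercube l) * 2 ^ l"
    by (rule num_copies_hypercube[OF G, symmetric])
  also have "\<dots> \<le> ex_num (hypercube n) (hypercube l) ?H * 2 ^ l"
    using num_copies_le_ex_num[OF simple_graph_hypercube G free] by simp
  finally have "real (2 ^ n * (m choose l)) \<le> real (ex_num (hypercube n) (hypercube l) ?H * 2 ^ l)"
    by (simp only: of_nat_le_iff)
  then have "real (2 ^ n * (m choose l)) / (2 ^ n * real (n choose l)) \<le>
      ex_density (hypercube n) (hypercube l) ?H"
    unfolding ex_density_hypercube by (rule divide_right_mono) simp
  then show ?thesis by simp
qed

section \<open>Logarithmic form of the bounds\<close>

lemma less_log2_iff: "k > 0 \<Longrightarrow> real l < log 2 (2 * real k) \<longleftrightarrow> 2 ^ l < 2 * k"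
proof -
  assume "k > 0"
  then have "real l < log 2 (2 * real k) \<longleftrightarrow> 2 ^ l < 2 * real k"
    by (simp add: less_log_iff powr_realpow)
  also have "\<dots> \<longleftrightarrow> real (2 ^ l) < real (2 * k)" by simp
  finally show ?thesis by (simp only: of_nat_less_iff)
qed

theorem theorem4:
  "(\<forall>k l n :: nat. k \<ge> 2 \<longrightarrow> l \<le> n \<longrightarrow> real l \<ge> log 2 (2 * real k) \<longrightarrow>
      ex_density (hypercube n) (hypercube l) (cycle_graph (2 * k)) = 0) \<and>
   (\<forall>k :: nat. k \<ge> 4 \<longrightarrow> k \<noteq> 5 \<longrightarrow>
      (\<exists>c :: real. c > 0 \<and>
        (\<forall>l n :: nat. 2 \<le> l \<longrightarrow> real l < log 2 (2 * real k) \<longrightarrow> log 2 (2 * real k) \<le> real n \<longrightarrow>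
          (let m = nat (\<lceil>log 2 (2 * real k)\<rceil> - 1);
               d = ex_density (hypercube n) (hypercube l) (cycle_graph (2 * k))
           in real (m choose l) * inverse (real (n choose l)) \<le> d \<and>
              d \<le> c * real n powr (- (1 / 16))))))"
proof (intro conjI allI impI)
  fix k l n :: nat
  assume "k \<ge> 2" "log 2 (2 * real k) \<le> real l"
  then show "ex_density (hypercube n) (hypercube l) (cycle_graph (2 * k)) = 0"
    using less_log2_iff[of k l] by (intro ex_density_hypercube_eq_0) auto
next
  fix k :: nat
  assume k: "4 \<le> k"
  show "\<exists>c :: real. c > 0 \<and>
        (\<forall>l n :: nat. 2 \<le> l \<longrightarrow> real l < log 2 (2 * real k) \<longrightarrow> log 2 (2 * real k) \<le> real n \<longrightarrow>
          (let m = nat (\<lceil>log 2 (2 * real k)\<rceil> - 1);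
               d = ex_density (hypercube n) (hypercube l) (cycle_graph (2 * k))
           in real (m choose l) * inverse (real (n choose l)) \<le> d \<and>
              d \<le> c * real n powr (- (1 / 16))))"
  \<comment> \<open>The constant must not depend on \<open>l\<close>: from
    \<open>l < 2 ^ l < 2 * k\<close>, the factor \<open>l ^ 2\<close> in the upper bound is replaced
    by \<open>(2 * k) ^ 2\<close>.\<close>
  proof (intro exI[of _ "4 * real k * real (2 * k) ^ 2"] conjI allI impI)
    show "0 < 4 * real k * real (2 * k) ^ 2" using k by simp
    fix l n :: nat
    assume l: "2 \<le> l" "real l < log 2 (2 * real k)" and n: "log 2 (2 * real k) \<le> real n"
    define m where "m = nat (\<lceil>log 2 (2 * real k)\<rceil> - 1)"
    define d where "d = ex_density (hypercube n) (hypercube l) (cycle_graph (2 * k))"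
    \<comment> \<open>The ceiling minus one lies strictly below the logarithm, and
      \<open>nat\<close> truncates nothing because the logarithm exceeds 2. Hence
      \<open>2 ^ m < 2 * k\<close> and \<open>m \<le> n\<close>.\<close>
    have "real m < log 2 (2 * real k)" using l unfolding m_def by linarith
    then have "real (m choose l) / real (n choose l) \<le> d"
      using n k less_log2_iff[of k m] unfolding d_def by (intro ex_density_hypercube_ge) linarith+
    moreover have "d \<le> 4 * real k * real (2 * k) ^ 2 * real n powr (- (1 / 16))"
    proof -
      have "l < 2 * k"
        using l k less_log2_iff[of k l] less_exp[of l] by linarith
      have "d \<le> 4 * real k * real l ^ 2 / real n"
        using k l n unfolding d_def by (intro ex_density_hypercube_le) auto
      also have "\<dots> \<le> 4 * real k * real (2 * k) ^ 2 / real n"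
        using \<open>l < 2 * k\<close> by (intro divide_right_mono mult_left_mono power_mono) auto
      also have "\<dots> = 4 * real k * real (2 * k) ^ 2 * real n powr (- 1)"
        using l n by (simp add: powr_minus divide_inverse)
      \<comment> \<open>The decay of order \<open>1 / n\<close> is weakened to the stated exponent,
        as \<open>n\<close> is at least 1.\<close>
      also have "\<dots> \<le> 4 * real k * real (2 * k) ^ 2 * real n powr (- (1 / 16))"
        using l n by (intro mult_left_mono powr_mono) auto
      finally show ?thesis .
    qed
    ultimately have "real (m choose l) * inverse (real (n choose l)) \<le> d \<and>
        d \<le> 4 * real k * real (2 * k) ^ 2 * real n powr (- (1 / 16))"
      by (simp only: divide_inverse)
    then show "let m = nat (\<lceil>log 2 (2 * real k)\<rceil> - 1);
               d = ex_density (hypercube n) (hypercube l) (cycle_graph (2 * k))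
           in real (m choose l) * inverse (real (n choose l)) \<le> d \<and>
              d \<le> 4 * real k * real (2 * k) ^ 2 * real n powr (- (1 / 16))"
      unfolding Let_def m_def d_def .
  qed
qed

end
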